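(* Let $\mathcal A$ and $\mathfrak A$ be Banach algebras such that $\mathcal A$ is a Banach $\mathfrak A$-bimodule with compatible actions. An operator $T$ is in $\mathrm{LM}(\mathcal A\rtimes\mathfrak A)$ if and only if there exist $T^1_{\mathcal A}\in\mathrm{Hom}_{\mathfrak A}(\mathcal A,\mathcal A)$, $T^1_{\mathfrak A}\in\mathrm{Hom}_{\mathfrak A}(\mathfrak A,\mathcal A)$, $T^2_{\mathfrak A}\in\mathrm{LM}(\mathfrak A)$ and $T^2_{\mathcal A}\in\mathrm{Hom}_{\mathfrak A}(\mathcal A,\mathfrak A)$ such that for all $a,b\in\mathcal A$ and $\beta\in\mathfrak A$: (i) $T((a,\beta))=(T^1_{\mathcal A}(a)+T^1_{\mathfrak A}(\beta),\ T^2_{\mathcal A}(a)+T^2_{\mathfrak A}(\beta))$; (ii) $T^1_{\mathcal A}(ab)=aT^1_{\mathcal A}(b)+a\cdot T^2_{\mathcal A}(b)$; (iii) $T^1_{\mathcal A}(a\cdot\beta)=aT^1_{\mathfrak A}(\beta)+a\cdot T^2_{\mathfrak A}(\beta)$; (iv) $T^2_{\mathcal A}(ab)=T^2_{\mathcal A}(a\cdot\beta)=0$.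
   Context: The actions of $\mathfrak A$ on $\mathcal A$ are compatible if for all $a,b\in\mathcal A$ and $\beta\in\mathfrak A$: $\beta\cdot(ab)=(\beta\cdot a)b$, $(ab)\cdot\beta=a(b\cdot\beta)$, $a(\beta\cdot b)=(a\cdot\beta)b$. The amalgamated duplication $\mathcal A\rtimes\mathfrak A$ is $\mathcal A\times\mathfrak A$ with product $(a,\beta)(b,\gamma)=(ab+a\cdot\gamma+\beta\cdot b,\ \beta\gamma)$ and norm $\|(a,\beta)\|=\|a\|+\|\beta\|$. For a Banach algebra $\mathcal C$ and Banach $\mathcal C$-bimodules $\mathcal X,\mathcal Y$, $\mathrm{Hom}_{\mathcal C}(\mathcal X,\mathcal Y)$ is the space of bounded linear left $\mathcal C$-module maps $T:\mathcal X\to\mathcal Y$, i.e. $T(c\cdot x)=c\cdot T(x)$ for all $c\in\mathcal C$, $x\in\mathcal X$; and $\mathrm{LM}(\mathcal C)=\mathrm{Hom}_{\mathcal C}(\mathcal C,\mathcal C)$, where $\mathcal C$ acts on itself by multiplication. *)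

theory Defs
  imports "HOL-Analysis.Analysis"
begin

section \<open>Complex Banach spaces and Banach algebras\<close>

text \<open>
  The scalar field is the field of complex numbers. The underlying real structure is
  the one of the library classes; \<open>scaleR_scaleC\<close> ties the two together (and yields
  that \<open>1\<close> acts as the identity). Banach algebras need not be unital or commutative.
\<close>

class complex_banach = banach +
  fixes scaleC :: "complex \<Rightarrow> 'a \<Rightarrow> 'a" (infixr "*\<^sub>C" 75)
  assumes scaleC_add_right: "c *\<^sub>C (x + y) = c *\<^sub>C x + c *\<^sub>C y"
    and scaleC_add_left: "(c + d) *\<^sub>C x = c *\<^sub>C x + d *\<^sub>C x"
    and scaleC_scaleC: "c *\<^sub>C d *\<^sub>C x = (c * d) *\<^sub>C x"
    and scaleR_scaleC: "r *\<^sub>R x = complex_of_real r *\<^sub>C x"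
    and norm_scaleC: "norm (c *\<^sub>C x) = cmod c * norm x"

class complex_banach_algebra = complex_banach + real_normed_algebra +
  assumes mult_scaleC_left: "(c *\<^sub>C x) * y = c *\<^sub>C (x * y)"
    and mult_scaleC_right: "x * (c *\<^sub>C y) = c *\<^sub>C (x * y)"

definition bounded_clinear :: "('x::complex_banach \<Rightarrow> 'y::complex_banach) \<Rightarrow> bool" where
  "bounded_clinear T \<longleftrightarrow> bounded_linear T \<and> (\<forall>c x. T (c *\<^sub>C x) = c *\<^sub>C T x)"


section \<open>Banach bimodules and module maps\<close>

text \<open>
  \<^const>\<open>bounded_bilinear\<close> asks for some constant \<open>K\<close> with
  \<open>norm (lact c x) \<le> norm c * norm x * K\<close>, so contractive actions (\<open>K = 1\<close>) are included.
\<close>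

locale banach_bimodule =
  fixes lact :: "'c::complex_banach_algebra \<Rightarrow> 'x::complex_banach \<Rightarrow> 'x"
    and ract :: "'x \<Rightarrow> 'c \<Rightarrow> 'x"
  assumes bounded_bilinear_lact: "bounded_bilinear lact"
    and lact_scaleC_left: "lact (k *\<^sub>C c) x = k *\<^sub>C lact c x"
    and lact_scaleC_right: "lact c (k *\<^sub>C x) = k *\<^sub>C lact c x"
    and bounded_bilinear_ract: "bounded_bilinear ract"
    and ract_scaleC_left: "ract (k *\<^sub>C x) c = k *\<^sub>C ract x c"
    and ract_scaleC_right: "ract x (k *\<^sub>C c) = k *\<^sub>C ract x c"
    and lact_mult: "lact (c * d) x = lact c (lact d x)"
    and ract_mult: "ract x (c * d) = ract (ract x c) d"
    and lact_ract: "ract (lact c x) d = lact c (ract x d)"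

definition compatible_actions ::
  "('b::complex_banach_algebra \<Rightarrow> 'a::complex_banach_algebra \<Rightarrow> 'a) \<Rightarrow> ('a \<Rightarrow> 'b \<Rightarrow> 'a) \<Rightarrow> bool" where
  "compatible_actions lact ract \<longleftrightarrow>
     (\<forall>a b \<beta>. lact \<beta> (a * b) = lact \<beta> a * b \<and>
              ract (a * b) \<beta> = a * ract b \<beta> \<and>
              a * lact \<beta> b = ract a \<beta> * b)"

text \<open>
  Bounded linear left module maps. The algebra enters only through its left actions on
  the two modules. A Banach algebra acts on itself by its multiplication, which is passed
  explicitly because that of the amalgamated duplication below depends on parameters.
\<close>

definition left_module_hom ::
  "('c \<Rightarrow> 'x::complex_banach \<Rightarrow> 'x) \<Rightarrow> ('c \<Rightarrow> 'y::complex_banach \<Rightarrow> 'y) \<Rightarrow> ('x \<Rightarrow> 'y) set" where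
  "left_module_hom lactX lactY =
     {T. bounded_clinear T \<and> (\<forall>c x. T (lactX c x) = lactY c (T x))}"

definition LM :: "('c::complex_banach \<Rightarrow> 'c \<Rightarrow> 'c) \<Rightarrow> ('c \<Rightarrow> 'c) set" where
  "LM mul = left_module_hom mul mul"

lemma banach_bimodule_mult:
  "banach_bimodule ((*) :: 'a::complex_banach_algebra \<Rightarrow> 'a \<Rightarrow> 'a) (*)"
  by (rule banach_bimodule.intro)
    (auto simp: bounded_bilinear_mult mult_scaleC_left mult_scaleC_right mult.assoc)


section \<open>The amalgamated duplication\<close>

text \<open>
  A copy of the product type is used because the library norm on pairs is the Euclidean
  one, whereas the amalgamated duplication carries the sum of the two norms.
\<close>

datatype ('a, 'b) dup = Dup (dup_fst: 'a) (dup_snd: 'b)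

instantiation dup :: (real_normed_vector, real_normed_vector) real_normed_vector
begin

definition "0 = Dup 0 0"
definition "x + y = Dup (dup_fst x + dup_fst y) (dup_snd x + dup_snd y)"
definition "x - y = Dup (dup_fst x - dup_fst y) (dup_snd x - dup_snd y)"
definition "- x = Dup (- dup_fst x) (- dup_snd x)"
definition "r *\<^sub>R x = Dup (r *\<^sub>R dup_fst x) (r *\<^sub>R dup_snd x)"
definition norm_dup_def: "norm x = norm (dup_fst x) + norm (dup_snd x)"
definition dist_dup_def: "dist x y = norm (x - y :: ('a, 'b) dup)"
definition "sgn x = inverse (norm x) *\<^sub>R (x :: ('a, 'b) dup)"
definition uniformity_dup_def:
  "(uniformity :: (('a, 'b) dup \<times> ('a, 'b) dup) filter) =
     (INF e\<in>{0<..}. principal {(x, y). dist x y < e})"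
definition open_dup_def:
  "open (U :: ('a, 'b) dup set) \<longleftrightarrow>
     (\<forall>x\<in>U. \<forall>\<^sub>F (x', y) in uniformity. x' = x \<longrightarrow> y \<in> U)"

instance
proof
  fix x y :: "('a, 'b) dup" and r :: real
  show "norm (x + y) \<le> norm x + norm y"
    using norm_triangle_ineq[of "dup_fst x" "dup_fst y"]
      norm_triangle_ineq[of "dup_snd x" "dup_snd y"]
    by (simp add: norm_dup_def plus_dup_def)
  show "norm x = 0 \<longleftrightarrow> x = 0"
    by (cases x) (simp add: norm_dup_def zero_dup_def add_nonneg_eq_0_iff)
qed (auto simp: zero_dup_def plus_dup_def minus_dup_def uminus_dup_def scaleR_dup_def
    dist_dup_def norm_dup_def sgn_dup_def uniformity_dup_def open_dup_def
    algebra_simps)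

end

instance dup :: (banach, banach) banach
proof
  fix X :: "nat \<Rightarrow> ('a, 'b) dup"
  assume X: "Cauchy X"
  have le: "dist (dup_fst x) (dup_fst y) \<le> dist x y" "dist (dup_snd x) (dup_snd y) \<le> dist x y"
    for x y :: "('a, 'b) dup"
    by (auto simp: dist_dup_def norm_dup_def minus_dup_def dist_norm)
  have "Cauchy (\<lambda>n. dup_fst (X n))" "Cauchy (\<lambda>n. dup_snd (X n))"
    using X le unfolding Cauchy_def by (meson le_less_trans)+
  then obtain a b where "(\<lambda>n. dup_fst (X n)) \<longlonglongrightarrow> a" "(\<lambda>n. dup_snd (X n)) \<longlonglongrightarrow> b"
    by (auto simp: Cauchy_convergent_iff convergent_def)
  then have "(\<lambda>n. norm (dup_fst (X n) - a) + norm (dup_snd (X n) - b)) \<longlonglongrightarrow> 0"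
    by (intro tendsto_add_zero tendsto_norm_zero) (auto simp: LIM_zero_iff)
  then have "(\<lambda>n. dist (X n) (Dup a b)) \<longlonglongrightarrow> 0"
    by (simp add: dist_dup_def norm_dup_def minus_dup_def)
  then show "convergent X"
    unfolding convergent_def using tendsto_dist_iff by blast
qed

instantiation dup :: (complex_banach, complex_banach) complex_banach
begin

definition "c *\<^sub>C x = Dup (c *\<^sub>C dup_fst x) (c *\<^sub>C dup_snd x)"

instance
  by standard
    (auto simp: plus_dup_def scaleR_dup_def scaleC_dup_def norm_dup_def scaleC_add_right
      scaleC_add_left scaleC_scaleC scaleR_scaleC norm_scaleC algebra_simps)

end

definition dup_mult ::
  "('b::complex_banach_algebra \<Rightarrow> 'a::complex_banach_algebra \<Rightarrow> 'a) \<Rightarrow> ('a \<Rightarrow> 'b \<Rightarrow> 'a)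
    \<Rightarrow> ('a, 'b) dup \<Rightarrow> ('a, 'b) dup \<Rightarrow> ('a, 'b) dup" where
  "dup_mult lact ract x y =
     Dup (dup_fst x * dup_fst y + ract (dup_fst x) (dup_snd y) + lact (dup_snd x) (dup_fst y))
         (dup_snd x * dup_snd y)"

lemma dup_mult_Dup [simp]:
  "dup_mult lact ract (Dup a \<beta>) (Dup b \<gamma>) = Dup (a * b + ract a \<gamma> + lact \<beta> b) (\<beta> * \<gamma>)"
  by (simp add: dup_mult_def)

lemma dup_mult_assoc:
  assumes "banach_bimodule lact ract" "compatible_actions lact ract"
  shows "dup_mult lact ract (dup_mult lact ract x y) z =
         dup_mult lact ract x (dup_mult lact ract y z)"
proof -
  interpret banach_bimodule lact ract by fact
  interpret l: bounded_bilinear lact by (rule bounded_bilinear_lact)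
  interpret r: bounded_bilinear ract by (rule bounded_bilinear_ract)
  show ?thesis
    using assms(2)
    by (cases x; cases y; cases z)
      (simp add: compatible_actions_def lact_mult ract_mult lact_ract l.add_right
        l.add_left r.add_left r.add_right distrib_left distrib_right mult.assoc add_ac)
qed

lemma norm_dup_mult_le:
  assumes "\<And>\<beta> a. norm (lact \<beta> a) \<le> norm \<beta> * norm a"
    and "\<And>a \<beta>. norm (ract a \<beta>) \<le> norm a * norm \<beta>"
  shows "norm (dup_mult lact ract x y) \<le> norm x * norm y"
proof (cases x; cases y)
  fix a \<beta> b \<gamma> assume [simp]: "x = Dup a \<beta>" "y = Dup b \<gamma>"
  have "norm (a * b + ract a \<gamma> + lact \<beta> b)
      \<le> norm a * norm b + norm a * norm \<gamma> + norm \<beta> * norm b"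
    by (intro norm_triangle_mono norm_mult_ineq assms)
  then show "norm (dup_mult lact ract x y) \<le> norm x * norm y"
    using norm_mult_ineq[of \<beta> \<gamma>] by (simp add: norm_dup_def algebra_simps)
qed

end

theory Submission
  imports Defs
begin

text \<open>
  An operator on a direct sum is a \<open>2 \<times> 2\<close> matrix of operators between the summands, and it
  is bounded and linear exactly when its four entries are (\<open>bounded_clinear_dup_iff\<close>).
  What remains is to read the equation \<open>T (x y) = x T y\<close> in terms of the entries. Both sides
  are biadditive in \<open>x\<close> and \<open>y\<close>, so it is enough to test it when each of \<open>x\<close> and \<open>y\<close> lies in one
  of the two summands (\<open>dup_mult_left_linear_iff\<close>):

  \<^item> \<open>x = (0, \<beta>)\<close>, \<open>y = (b, 0)\<close>: the product is \<open>(\<beta> \<cdot> b, 0)\<close>, and the equation says that both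
    entries starting at \<open>\<A>\<close> are left \<open>\<BB>\<close>-module maps;
  \<^item> \<open>x = (0, \<beta>)\<close>, \<open>y = (0, \<gamma>)\<close>: the same for the entries starting at \<open>\<BB>\<close>;
  \<^item> \<open>x = (a, 0)\<close>, \<open>y = (b, 0)\<close>: the product is \<open>(a b, 0)\<close>, and since \<open>\<A>\<close> is an ideal,
    \<open>x T y\<close> has second component zero; this yields the first identity on products and the
    vanishing of the lower left entry on them;
  \<^item> \<open>x = (a, 0)\<close>, \<open>y = (0, \<gamma>)\<close>: the same for the elements \<open>a \<cdot> \<gamma>\<close>.

  Here \<open>\<A>\<close> is the first summand and \<open>\<BB>\<close> the algebra that acts on it.
\<close>

lemma bounded_clinear_compose:
  assumes "bounded_clinear g" "bounded_clinear f"
  shows "bounded_clinear (\<lambda>x. g (f x))"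
  using assms by (auto simp: bounded_clinear_def intro: bounded_linear_compose)

lemma bounded_clinear_add:
  assumes "bounded_clinear f" "bounded_clinear g"
  shows "bounded_clinear (\<lambda>x. f x + g x)"
  using assms by (auto simp: bounded_clinear_def scaleC_add_right intro: bounded_linear_add)

lemma bounded_clinear_imp_linear:
  assumes "bounded_clinear f"
  shows "linear f"
  using assms by (simp add: bounded_clinear_def bounded_linear.linear)

lemma scaleC_zero [simp]: "c *\<^sub>C (0 :: 'a::complex_banach) = 0"
  using scaleC_add_right[of c "0 :: 'a" 0] by simp

lemma bounded_clinear_dup_fst:
  "bounded_clinear (dup_fst :: ('a::complex_banach, 'b::complex_banach) dup \<Rightarrow> 'a)"
  unfolding bounded_clinear_def
  by (auto intro!: bounded_linear_intro[where K = 1]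
      simp: plus_dup_def scaleR_dup_def scaleC_dup_def norm_dup_def)

lemma bounded_clinear_dup_snd:
  "bounded_clinear (dup_snd :: ('a::complex_banach, 'b::complex_banach) dup \<Rightarrow> 'b)"
  unfolding bounded_clinear_def
  by (auto intro!: bounded_linear_intro[where K = 1]
      simp: plus_dup_def scaleR_dup_def scaleC_dup_def norm_dup_def)

lemma bounded_clinear_Dup_left:
  "bounded_clinear (\<lambda>a. Dup a 0 :: ('a::complex_banach, 'b::complex_banach) dup)"
  unfolding bounded_clinear_def
  by (auto intro!: bounded_linear_intro[where K = 1]
      simp: plus_dup_def scaleR_dup_def scaleC_dup_def norm_dup_def)

lemma bounded_clinear_Dup_right:
  "bounded_clinear (\<lambda>b. Dup 0 b :: ('a::complex_banach, 'b::complex_banach) dup)"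
  unfolding bounded_clinear_def
  by (auto intro!: bounded_linear_intro[where K = 1]
      simp: plus_dup_def scaleR_dup_def scaleC_dup_def norm_dup_def)

lemma bounded_clinear_Dup:
  fixes f :: "'x::complex_banach \<Rightarrow> 'a::complex_banach" and g :: "'x \<Rightarrow> 'b::complex_banach"
  assumes "bounded_clinear f" "bounded_clinear g"
  shows "bounded_clinear (\<lambda>x. Dup (f x) (g x))"
  using bounded_clinear_add[OF bounded_clinear_compose[OF bounded_clinear_Dup_left assms(1)]
      bounded_clinear_compose[OF bounded_clinear_Dup_right assms(2)]]
  by (simp add: plus_dup_def)

text \<open>
  Entries of \<open>T\<close> are obtained by composing \<open>T\<close> with the coordinate embeddings and
  projections; conversely \<open>T\<close> is a sum of such composites of its entries.
\<close>

lemma bounded_clinear_dup_iff: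
  fixes T :: "('a::complex_banach, 'b::complex_banach) dup
      \<Rightarrow> ('c::complex_banach, 'd::complex_banach) dup"
  shows "bounded_clinear T \<longleftrightarrow>
    (\<exists>TA1 TB1 TA2 TB2.
       bounded_clinear TA1 \<and> bounded_clinear TB1 \<and> bounded_clinear TA2 \<and> bounded_clinear TB2 \<and>
       (\<forall>a \<beta>. T (Dup a \<beta>) = Dup (TA1 a + TB1 \<beta>) (TA2 a + TB2 \<beta>)))"
    (is "_ \<longleftrightarrow> ?R")
proof
  assume T: "bounded_clinear T"
  note entry = bounded_clinear_compose[OF _ bounded_clinear_compose[OF T]]
  show ?R
  proof (intro exI conjI allI)
    show "bounded_clinear (\<lambda>a. dup_fst (T (Dup a 0)))"
      by (rule entry[OF bounded_clinear_dup_fst bounded_clinear_Dup_left])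
    show "bounded_clinear (\<lambda>\<beta>. dup_fst (T (Dup 0 \<beta>)))"
      by (rule entry[OF bounded_clinear_dup_fst bounded_clinear_Dup_right])
    show "bounded_clinear (\<lambda>a. dup_snd (T (Dup a 0)))"
      by (rule entry[OF bounded_clinear_dup_snd bounded_clinear_Dup_left])
    show "bounded_clinear (\<lambda>\<beta>. dup_snd (T (Dup 0 \<beta>)))"
      by (rule entry[OF bounded_clinear_dup_snd bounded_clinear_Dup_right])
    show "T (Dup a \<beta>) =
        Dup (dup_fst (T (Dup a 0)) + dup_fst (T (Dup 0 \<beta>)))
            (dup_snd (T (Dup a 0)) + dup_snd (T (Dup 0 \<beta>)))" for a \<beta>
      using linear_add[OF bounded_clinear_imp_linear[OF T], of "Dup a 0" "Dup 0 \<beta>"]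
      by (simp add: plus_dup_def)
  qed
next
  assume ?R
  then obtain TA1 TB1 TA2 TB2 where
    entries: "bounded_clinear TA1" "bounded_clinear TB1" "bounded_clinear TA2" "bounded_clinear TB2"
    and T: "\<And>a \<beta>. T (Dup a \<beta>) = Dup (TA1 a + TB1 \<beta>) (TA2 a + TB2 \<beta>)"
    by blast
  have "T = (\<lambda>x. Dup (TA1 (dup_fst x) + TB1 (dup_snd x)) (TA2 (dup_fst x) + TB2 (dup_snd x)))"
    by (metis T dup.collapse)
  then show "bounded_clinear T"
    by (simp add: bounded_clinear_Dup bounded_clinear_add
        bounded_clinear_compose[OF _ bounded_clinear_dup_fst]
        bounded_clinear_compose[OF _ bounded_clinear_dup_snd] entries)
qed

text \<open>
  The four pairs of equations on the right are \<open>T (x y) = x T y\<close> for \<open>x\<close> and \<open>y\<close> in the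
  summands, compared componentwise. By biadditivity their sum is the equation for arbitrary
  \<open>x\<close> and \<open>y\<close>.
\<close>

lemma dup_mult_left_linear_iff:
  fixes lact :: "'b::complex_banach_algebra \<Rightarrow> 'a::complex_banach_algebra \<Rightarrow> 'a"
  assumes lact: "bounded_bilinear lact" and ract: "bounded_bilinear ract"
    and entries: "linear TA1" "linear TB1" "linear TA2" "linear TB2"
    and T: "\<And>a \<beta>. T (Dup a \<beta>) = Dup (TA1 a + TB1 \<beta>) (TA2 a + TB2 \<beta>)"
  shows "(\<forall>x y. T (dup_mult lact ract x y) = dup_mult lact ract x (T y)) \<longleftrightarrow>
    (\<forall>\<beta> b. TA1 (lact \<beta> b) = lact \<beta> (TA1 b) \<and> TA2 (lact \<beta> b) = \<beta> * TA2 b) \<and>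
    (\<forall>\<beta> \<gamma>. TB1 (\<beta> * \<gamma>) = lact \<beta> (TB1 \<gamma>) \<and> TB2 (\<beta> * \<gamma>) = \<beta> * TB2 \<gamma>) \<and>
    (\<forall>a b. TA1 (a * b) = a * TA1 b + ract a (TA2 b) \<and> TA2 (a * b) = 0) \<and>
    (\<forall>a \<gamma>. TA1 (ract a \<gamma>) = a * TB1 \<gamma> + ract a (TB2 \<gamma>) \<and> TA2 (ract a \<gamma>) = 0)"
    (is "?L \<longleftrightarrow> ?R")
proof -
  interpret l: bounded_bilinear lact by fact
  interpret r: bounded_bilinear ract by fact
  note zeros = l.zero_left l.zero_right r.zero_left r.zero_right entries[THEN linear_0]
  note adds = l.add_right r.add_right entries[THEN linear_add]
  show ?thesis
  proof
    assume L: ?L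
    show ?R
    proof (intro conjI allI)
      fix \<beta> b
      show "TA1 (lact \<beta> b) = lact \<beta> (TA1 b)" "TA2 (lact \<beta> b) = \<beta> * TA2 b"
        using L[rule_format, of "Dup 0 \<beta>" "Dup b 0"] by (simp_all add: T zeros)
    next
      fix \<beta> \<gamma>
      show "TB1 (\<beta> * \<gamma>) = lact \<beta> (TB1 \<gamma>)" "TB2 (\<beta> * \<gamma>) = \<beta> * TB2 \<gamma>"
        using L[rule_format, of "Dup 0 \<beta>" "Dup 0 \<gamma>"] by (simp_all add: T zeros)
    next
      fix a b
      show "TA1 (a * b) = a * TA1 b + ract a (TA2 b)" "TA2 (a * b) = 0"
        using L[rule_format, of "Dup a 0" "Dup b 0"] by (simp_all add: T zeros)
    next
      fix a \<gamma>
      show "TA1 (ract a \<gamma>) = a * TB1 \<gamma> + ract a (TB2 \<gamma>)" "TA2 (ract a \<gamma>) = 0"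
        using L[rule_format, of "Dup a 0" "Dup 0 \<gamma>"] by (simp_all add: T zeros)
    qed
  next
    assume R: ?R
    show ?L
    proof (intro allI)
      fix x y
      show "T (dup_mult lact ract x y) = dup_mult lact ract x (T y)"
        by (cases x; cases y) (simp add: T adds R distrib_left add_ac)
    qed
  qed
qed

theorem proposition3p5:
  fixes lact :: "'b::complex_banach_algebra \<Rightarrow> 'a::complex_banach_algebra \<Rightarrow> 'a"
    and ract :: "'a \<Rightarrow> 'b \<Rightarrow> 'a"
    and T :: "('a, 'b) dup \<Rightarrow> ('a, 'b) dup"
  assumes "banach_bimodule lact ract"
    and "compatible_actions lact ract"
  shows "T \<in> LM (dup_mult lact ract) \<longleftrightarrow>
    (\<exists>TA1 \<in> left_module_hom lact lact.
     \<exists>TB1 \<in> left_module_hom ((*) :: 'b \<Rightarrow> 'b \<Rightarrow> 'b) lact.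
     \<exists>TB2 \<in> LM ((*) :: 'b \<Rightarrow> 'b \<Rightarrow> 'b).
     \<exists>TA2 \<in> left_module_hom lact ((*) :: 'b \<Rightarrow> 'b \<Rightarrow> 'b).
       \<forall>a b \<beta>.
         T (Dup a \<beta>) = Dup (TA1 a + TB1 \<beta>) (TA2 a + TB2 \<beta>) \<and>
         TA1 (a * b) = a * TA1 b + ract a (TA2 b) \<and>
         TA1 (ract a \<beta>) = a * TB1 \<beta> + ract a (TB2 \<beta>) \<and>
         TA2 (a * b) = 0 \<and> TA2 (ract a \<beta>) = 0)"
proof -
  from assms(1) interpret banach_bimodule lact ract .
  note entry_iff = dup_mult_left_linear_iff[OF bounded_bilinear_lact bounded_bilinear_ract]
  show ?thesis (is "_ \<longleftrightarrow> ?R")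
  proof
    assume "T \<in> LM (dup_mult lact ract)"
    then have "bounded_clinear T"
      and T_mult: "\<forall>x y. T (dup_mult lact ract x y) = dup_mult lact ract x (T y)"
      by (auto simp: LM_def left_module_hom_def)
    then obtain TA1 TB1 TA2 TB2 where
      entries: "bounded_clinear TA1" "bounded_clinear TB1"
        "bounded_clinear TA2" "bounded_clinear TB2"
      and T: "\<And>a \<beta>. T (Dup a \<beta>) = Dup (TA1 a + TB1 \<beta>) (TA2 a + TB2 \<beta>)"
      unfolding bounded_clinear_dup_iff by blast
    note eqs = T_mult[unfolded entry_iff[OF entries[THEN bounded_clinear_imp_linear] T]]
    show ?R
    proof (intro bexI)
      show "\<forall>a b \<beta>. T (Dup a \<beta>) = Dup (TA1 a + TB1 \<beta>) (TA2 a + TB2 \<beta>) \<and>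
         TA1 (a * b) = a * TA1 b + ract a (TA2 b) \<and>
         TA1 (ract a \<beta>) = a * TB1 \<beta> + ract a (TB2 \<beta>) \<and>
         TA2 (a * b) = 0 \<and> TA2 (ract a \<beta>) = 0"
        using eqs T by simp
    qed (use eqs entries in \<open>simp_all add: LM_def left_module_hom_def\<close>)
  next
    assume ?R
    then obtain TA1 TB1 TA2 TB2 where
      homs: "TA1 \<in> left_module_hom lact lact" "TB1 \<in> left_module_hom (*) lact"
        "TB2 \<in> LM (*)" "TA2 \<in> left_module_hom lact (*)"
      and eqs: "\<forall>a b \<beta>. T (Dup a \<beta>) = Dup (TA1 a + TB1 \<beta>) (TA2 a + TB2 \<beta>) \<and>
         TA1 (a * b) = a * TA1 b + ract a (TA2 b) \<and>
         TA1 (ract a \<beta>) = a * TB1 \<beta> + ract a (TB2 \<beta>) \<and>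
         TA2 (a * b) = 0 \<and> TA2 (ract a \<beta>) = 0"
      by (elim bexE)
    have entries: "bounded_clinear TA1" "bounded_clinear TB1"
        "bounded_clinear TA2" "bounded_clinear TB2"
      using homs by (simp_all add: LM_def left_module_hom_def)
    have T: "T (Dup a \<beta>) = Dup (TA1 a + TB1 \<beta>) (TA2 a + TB2 \<beta>)" for a \<beta>
      using eqs by simp
    have "bounded_clinear T"
      unfolding bounded_clinear_dup_iff using entries T by blast
    moreover have "\<forall>x y. T (dup_mult lact ract x y) = dup_mult lact ract x (T y)"
      unfolding entry_iff[OF entries[THEN bounded_clinear_imp_linear] T]
      using homs eqs by (simp add: LM_def left_module_hom_def)
    ultimately show "T \<in> LM (dup_mult lact ract)"
      by (simp add: LM_def left_module_hom_def)
  qed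
qed

end
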